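(* Let $a,A\ge 0$ and $b,B\ge 1$ be integers with $\gcd(a,b)=1$, and assume $B\nmid A$ whenever $b=1$. Let $k\geq 1$ and $h$ be integers with $\gcd(h,k)=1$, and put $k'=\frac{k}{\gcd(k,B)}$. If $\frac{h}{k}\notin\mathcal{Q}_{a,b,A,B}$ and $\left\{k'\left(\frac ab+\frac{Ah}{k}\right)\right\}\in\left(\frac16,\frac56\right)$, then $$\lim_{q\to\zeta_k^h}g_3(\zeta_b^a q^A,q^B)=\frac{1}{1-\frac{1}{2-2\cos\left(2\pi k'\left(\frac ab+\frac{Ah}{k}\right)\right)}}\sum_{j=1}^{k'}\frac{\zeta_k^{hBj(j-1)}}{(\zeta_b^a\zeta_k^{hA},\zeta_b^{-a}\zeta_k^{h(B-A)};\zeta_k^{hB})_j}.$$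
   Context: Notation: $\zeta_k^h:=e^{2\pi i h/k}$. For $x\in\mathbb{R}$, $\{x\}$ is the unique number in $[0,1)$ with $x-\{x\}\in\mathbb{Z}$. For $n\in\{0,1,2,\dots\}\cup\{\infty\}$, $(a;q)_n:=\prod_{j=0}^{n-1}(1-aq^j)$ and $(a_1,\dots,a_m;q)_n:=\prod_{i=1}^m(a_i;q)_n$ (for finite $n$ this is also used when $q$ is a root of unity). The universal mock theta function $g_3$ is $g_3(x,q):=\sum_{n\ge1}\frac{q^{n(n-1)}}{(x,q/x;q)_n}$ for $0<|q|<1$. Limits are radial from within the unit disc: for a root of unity $\zeta$ and a function $F$ on the unit disc, $\lim_{q\to\zeta}F(q):=\lim_{t\to0^+}F(\zeta e^{-t})$. The set of cusps is $\mathcal{Q}_{a,b,A,B}:=\left\{\frac hk\in\mathbb{Q}: b\mid k\text{ and }\gcd(k,B)\mid\left(\frac{ak}{b}+Ah\right)\right\}$, with $\frac hk$ written in lowest terms. *)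

theory Defs
  imports Complex_Main
begin

definition zeta :: "nat \<Rightarrow> int \<Rightarrow> complex" where
  "zeta k h = exp (2 * of_real pi * \<i> * of_int h / of_nat k)"

definition qpoch :: "complex \<Rightarrow> complex \<Rightarrow> nat \<Rightarrow> complex" where
  "qpoch a q n = (\<Prod>j<n. 1 - a * q ^ j)"

text \<open>Several parameters: \<open>(a\<^sub>1, \<dots>, a\<^sub>m; q)\<^sub>n\<close>.\<close>

definition qpochs :: "complex list \<Rightarrow> complex \<Rightarrow> nat \<Rightarrow> complex" where
  "qpochs as q n = (\<Prod>a\<leftarrow>as. qpoch a q n)"

text \<open>
  The universal mock theta function, meaningful for \<open>0 < \<bar>q\<bar> < 1\<close> and \<open>x\<close> not an integral
  power of \<open>q\<close>. The sum runs over \<open>n \<ge> 1\<close>, hence the shift by \<open>Suc\<close>.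
\<close>

definition g3 :: "complex \<Rightarrow> complex \<Rightarrow> complex" where
  "g3 x q = (\<Sum>m. let n = Suc m in q ^ (n * (n - 1)) / qpochs [x, q / x] q n)"

definition has_radial_limit :: "(complex \<Rightarrow> complex) \<Rightarrow> complex \<Rightarrow> complex \<Rightarrow> bool" where
  "has_radial_limit F z L \<longleftrightarrow>
     ((\<lambda>t::real. F (z * exp (- of_real t))) \<longlongrightarrow> L) (at_right 0)"

text \<open>The division \<open>(a * k) div b\<close> is exact because of the condition \<open>b dvd k\<close>.\<close>

definition cusps :: "nat \<Rightarrow> nat \<Rightarrow> nat \<Rightarrow> nat \<Rightarrow> rat set" where
  "cusps a b A B =
     {of_int h / of_nat k | (h :: int) (k :: nat).
        k \<ge> 1 \<and> coprime h (int k) \<and> b dvd k \<and>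
        int (gcd k B) dvd int ((a * k) div b) + int A * h}"

end

theory Submission
  imports Defs "HOL-Analysis.Analysis"
begin

text \<open>
  Put \<open>x = \<zeta>\<^sub>b\<^sup>a q\<^sup>A\<close>, let \<open>\<xi>\<close> be its limit, and let \<open>\<zeta>\<close>, a primitive \<open>N\<close>-th root of unity with
  \<open>N = k'\<close>, be the limit of \<open>q\<^sup>B\<close>. Advancing the summation index from \<open>n\<close> to \<open>n + N\<close> multiplies
  the term of the limiting series by \<open>1 / D\<close>, where \<open>D = \<bar>1 - \<xi>\<^sup>N\<bar>\<^sup>2 = 2 - 2 cos (2 \<pi> \<theta>) > 1\<close>, so the
  limiting series is a geometric series of blocks of length \<open>N\<close>. For \<open>q\<close> near the root of unity the
  modulus of this ratio is, uniformly in \<open>n\<close>, at most about \<open>y\<^sup>2 / \<bar>1 - y \<xi>\<^sup>N\<bar>\<^sup>2 \<le> 1 / D\<close> with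
  \<open>y = \<bar>q\<bar>\<close> to the power \<open>B n N\<close>. Hence the series is dominated by a fixed geometric series, and
  Tannery's theorem permits termwise passage to the limit.
\<close>

section \<open>Finite q-Pochhammer products and their value at a primitive root of unity\<close>

lemma qpoch_add: "qpoch a q (m + n) = qpoch a q m * qpoch (a * q ^ m) q n"
proof (induction n)
  case 0
  then show ?case by (simp add: qpoch_def)
next
  case (Suc n)
  then show ?case by (simp add: qpoch_def power_add mult_ac)
qed

lemma continuous_on_qpoch [continuous_intros]:
  assumes "continuous_on S f" and "continuous_on S g"
  shows "continuous_on S (\<lambda>x. qpoch (f x) (g x) n)"
  unfolding qpoch_def by (intro continuous_intros assms)

lemma tendsto_qpoch [tendsto_intros]:
  assumes "(f \<longlongrightarrow> a) F" and "(g \<longlongrightarrow> q) F"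
  shows "((\<lambda>x. qpoch (f x) (g x) n) \<longlongrightarrow> qpoch a q n) F"
  unfolding qpoch_def by (intro tendsto_intros assms)

text \<open>As polynomials in \<open>w\<close>, both sides have degree at most \<open>N\<close> and
  agree at the \<open>N + 1\<close> distinct points of \<open>A\<close>: at 0 both equal 1, and at
  the inverse powers of \<open>\<zeta>\<close> both vanish.\<close>

lemma qpoch_primitive_root:
  fixes \<zeta> w :: complex
  assumes root: "\<zeta> ^ N = 1" and inj: "inj_on (\<lambda>i. \<zeta> ^ i) {..<N}" and "N > 0"
  shows "qpoch w \<zeta> N = 1 - w ^ N"
proof -
  define p where "p = (\<Prod>i<N. [:1, - (\<zeta> ^ i):])"
  define r where "r = 1 - monom (1::complex) N"
  define A where "A = insert 0 ((\<lambda>i. inverse (\<zeta> ^ i)) ` {..<N})"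
  have nz: "\<zeta> \<noteq> 0"
    using root \<open>N > 0\<close> by (auto simp: power_0_left)
  have poly_p: "poly p w = qpoch w \<zeta> N" for w
    by (simp add: p_def poly_prod qpoch_def)
  have "inj_on (\<lambda>i. inverse (\<zeta> ^ i)) {..<N}"
    using inj by (auto simp: inj_on_def)
  then have "card A = Suc N"
    unfolding A_def using nz by (subst card_insert_disjoint) (auto simp: card_image)
  moreover have "degree p \<le> N"
  proof -
    have "degree p \<le> (\<Sum>i<N. degree [:1, - (\<zeta> ^ i):])"
      unfolding p_def by (rule degree_prod_sum_le[THEN order_trans]) auto
    also have "\<dots> \<le> (\<Sum>i<N. 1)"
      by (intro sum_mono) (auto intro: degree_pCons_le[THEN order_trans])
    finally show ?thesis by simp
  qed
  moreover have "degree r \<le> N"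
    unfolding r_def by (intro degree_diff_le) (auto simp: degree_monom_le)
  moreover have "poly p x = poly r x" if "x \<in> A" for x
  proof (cases "x = 0")
    case True
    then show ?thesis using \<open>N > 0\<close>
      by (simp add: poly_p r_def qpoch_def poly_monom power_0_left)
  next
    case False
    then obtain i where i: "i < N" "x = inverse (\<zeta> ^ i)"
      using \<open>x \<in> A\<close> by (auto simp: A_def)
    have "\<exists>j\<in>{..<N}. 1 - x * \<zeta> ^ j = 0"
      using i nz by (intro bexI[of _ i]) auto
    then have "poly p x = 0"
      by (simp add: poly_p qpoch_def)
    moreover have "x ^ N = 1"
      using i root by (simp add: power_inverse power_mult[symmetric] mult.commute)
        (simp add: power_mult)
    ultimately show ?thesis by (simp add: r_def poly_monom)
  qed
  ultimately have "p = r"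
    by (intro poly_eqI_degree[of A]) auto
  then show ?thesis
    by (simp add: poly_p[symmetric] r_def poly_monom)
qed

section \<open>Summands of the series and their quotient over \<open>N\<close> consecutive
  indices\<close>

definition g3_term :: "complex \<Rightarrow> complex \<Rightarrow> nat \<Rightarrow> complex" where
  "g3_term x q n = q ^ (n * (n - 1)) / qpochs [x, q / x] q n"

text \<open>At \<open>z = q ^ n\<close> this is the part of the denominator gained between the
  indices \<open>n\<close> and \<open>n + N\<close>. With \<open>z\<close> as a free variable,
  uniformity in \<open>n\<close> becomes uniformity over the closed unit disc.\<close>

definition g3_block :: "nat \<Rightarrow> complex \<Rightarrow> complex \<Rightarrow> complex \<Rightarrow> complex" where
  "g3_block N x q z = qpoch (z * x) q N * qpoch (z * q / x) q N"

lemma g3_eq: "g3 x q = (\<Sum>m. g3_term x q (Suc m))"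
  by (simp add: g3_def g3_term_def Let_def)

lemma g3_term_add:
  "g3_term x q (n + N) =
     g3_term x q n * (q ^ (2 * n * N) * q ^ (N * (N - 1))) / g3_block N x q (q ^ n)"
proof -
  have "(n + N) * (n + N - 1) = n * (n - 1) + (2 * n * N + N * (N - 1))"
    by (cases n; cases N) (simp_all add: algebra_simps)
  then show ?thesis
    by (simp add: g3_term_def g3_block_def qpochs_def qpoch_add power_add mult_ac)
qed

section \<open>Denominators at and near the root of unity\<close>

lemma sq_norm_one_minus_mult:
  fixes w :: complex
  assumes "norm w = 1"
  shows "(norm (1 - of_real y * w))\<^sup>2 = 1 - 2 * y * Re w + y\<^sup>2"
proof -
  have "(Re w)\<^sup>2 + (Im w)\<^sup>2 = 1"
    using assms by (simp add: cmod_def)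
  then have "(1 - y * Re w)\<^sup>2 + (y * Im w)\<^sup>2 = 1 - 2 * y * Re w + y\<^sup>2"
    by algebra
  then show ?thesis
    by (simp add: cmod_power2)
qed

text \<open>The limiting data: \<open>\<zeta>_root\<close> and \<open>\<zeta>_inj\<close> say that
  \<open>\<zeta>\<close> has exact order \<open>N\<close>, and \<open>Re_less\<close> is the
  condition \<open>D > 1\<close> that makes the limiting series converge.\<close>

locale root_data =
  fixes \<xi> \<zeta> :: complex and N :: nat
  assumes N_pos: "N > 0"
    and \<zeta>_root: "\<zeta> ^ N = 1"
    and \<zeta>_inj: "inj_on (\<lambda>i. \<zeta> ^ i) {..<N}"
    and norm_\<xi>: "norm \<xi> = 1"
    and Re_less: "Re (\<xi> ^ N) < 1 / 2"
begin

definition D :: real where "D = 2 - 2 * Re (\<xi> ^ N)"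

lemma D_gt_1: "D > 1"
  using Re_less by (simp add: D_def)

lemma \<xi>_nz [simp]: "\<xi> \<noteq> 0"
  using norm_\<xi> by auto

text \<open>Each of the two products collapses by \<open>qpoch_primitive_root\<close>. Since
  \<open>z ^ N\<close> is real and \<open>\<xi>\<close> lies on the unit circle, the resulting
  factors are complex conjugates.\<close>

lemma g3_block_limit:
  assumes "z ^ N = of_real y"
  shows "g3_block N \<xi> \<zeta> z = of_real (1 - 2 * y * Re (\<xi> ^ N) + y\<^sup>2)"
proof -
  have "\<xi> * cnj \<xi> = 1"
    using complex_norm_square[of \<xi>] norm_\<xi> by simp
  then have "inverse \<xi> = cnj \<xi>"
    by (rule inverse_unique)
  then have inv: "inverse \<xi> ^ N = cnj (\<xi> ^ N)" by simp
  have "g3_block N \<xi> \<zeta> z = (1 - (z * \<xi>) ^ N) * (1 - (z * \<zeta> / \<xi>) ^ N)"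
    by (simp add: g3_block_def qpoch_primitive_root \<zeta>_root \<zeta>_inj N_pos)
  also have "\<dots> = (1 - of_real y * \<xi> ^ N) * cnj (1 - of_real y * \<xi> ^ N)"
    using inv by (simp add: divide_inverse power_mult_distrib assms \<zeta>_root)
  also have "\<dots> = of_real ((norm (1 - of_real y * \<xi> ^ N))\<^sup>2)"
    by (simp only: complex_norm_square)
  also have "\<dots> = of_real (1 - 2 * y * Re (\<xi> ^ N) + y\<^sup>2)"
    by (subst sq_norm_one_minus_mult) (simp_all add: norm_power norm_\<xi>)
  finally show ?thesis .
qed

text \<open>For \<open>y \<in> [0,1]\<close> and \<open>c < 1/2\<close>, the point \<open>y = 1\<close> minimises \<open>(1 - 2yc + y\<^sup>2) / y\<^sup>2\<close>; this is
  where the restriction of \<open>\<theta>\<close> to \<open>(1/6, 5/6)\<close> enters.\<close>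
lemma norm_g3_block_limit_ge:
  assumes "z ^ N = of_real y" and "0 \<le> y" and "y \<le> 1"
  shows "norm (g3_block N \<xi> \<zeta> z) \<ge> D * y\<^sup>2" and "norm (g3_block N \<xi> \<zeta> z) \<ge> 3 / 4"
proof -
  define c where "c = Re (\<xi> ^ N)"
  have c: "c < 1 / 2" using Re_less by (simp add: c_def)
  have eq: "norm (g3_block N \<xi> \<zeta> z) = \<bar>1 - 2 * y * c + y\<^sup>2\<bar>"
    by (simp only: g3_block_limit[OF assms(1)] norm_of_real c_def)
  have "1 - 2 * y * c + y\<^sup>2 - D * y\<^sup>2 = (1 - y) * (1 + y - 2 * c * y)"
    by (simp add: D_def c_def power2_eq_square algebra_simps)
  moreover have "2 * c * y \<le> 1 * y"
    using c assms by (intro mult_right_mono) auto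
  then have "1 + y - 2 * c * y \<ge> 0" by linarith
  then have "(1 - y) * (1 + y - 2 * c * y) \<ge> 0"
    using assms by simp
  ultimately show "norm (g3_block N \<xi> \<zeta> z) \<ge> D * y\<^sup>2"
    using eq by linarith
  \<comment> \<open>The bound \<open>D * y\<^sup>2\<close> degenerates as \<open>y\<close> tends to
    0. The minimum of \<open>1 - y + y\<^sup>2\<close>, attained at \<open>y = 1 / 2\<close>, gives
    a positive floor independent of \<open>y\<close>.\<close>
  have "0 \<le> (y - 1 / 2)\<^sup>2" by simp
  then have "1 - y + y\<^sup>2 \<ge> 3 / 4"
    by (simp add: power2_eq_square algebra_simps)
  then have "1 - 2 * y * c + y\<^sup>2 \<ge> 3 / 4"
    using \<open>2 * c * y \<le> 1 * y\<close> by (simp add: mult_ac)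
  then show "norm (g3_block N \<xi> \<zeta> z) \<ge> 3 / 4"
    using eq by linarith
qed

text \<open>The block is jointly continuous in all its arguments, hence uniformly continuous on a
  compact neighbourhood of the limit point times the closed unit disc.\<close>

lemma g3_block_uniform_limit:
  assumes x: "(x \<longlongrightarrow> \<xi>) F" and q: "(q \<longlongrightarrow> \<zeta>) F" and "e > 0"
  shows "\<forall>\<^sub>F t in F. \<forall>z. norm z \<le> 1 \<longrightarrow>
           dist (g3_block N (x t) (q t) z) (g3_block N \<xi> \<zeta> z) < e"
proof -
  \<comment> \<open>Radius \<open>1/2\<close> around the unimodular \<open>\<xi>\<close> excludes 0,
    where the quotient \<open>q / x\<close> would be singular.\<close>
  define K where "K = (cball \<xi> (1/2) \<times> cball \<zeta> 1) \<times> cball (0::complex) 1"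
  define G where "G = (\<lambda>((u, v), z). g3_block N u v z)"
  have nz: "u \<noteq> 0" if "u \<in> cball \<xi> (1/2)" for u
    using that norm_\<xi> by auto
  have "continuous_on K G"
    unfolding G_def case_prod_beta g3_block_def
    by (intro continuous_intros) (auto simp: K_def nz)
  moreover have "compact K"
    unfolding K_def by (intro compact_Times compact_cball)
  ultimately have "uniformly_continuous_on K G"
    by (rule compact_uniformly_continuous)
  then obtain d where d: "d > 0"
    "\<And>u v. u \<in> K \<Longrightarrow> v \<in> K \<Longrightarrow> dist v u < d \<Longrightarrow> dist (G v) (G u) < e"
    using \<open>e > 0\<close> unfolding uniformly_continuous_on_def by blast
  have "\<forall>\<^sub>F t in F. dist (x t, q t) (\<xi>, \<zeta>) < min d (1/2)"
    by (rule tendstoD[OF tendsto_Pair[OF x q]]) (use d(1) in simp)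
  then show ?thesis
  proof eventually_elim
    case (elim t)
    show ?case
    proof (intro allI impI)
      fix z :: complex
      assume z: "norm z \<le> 1"
      have "dist (x t) \<xi> < 1/2" "dist (q t) \<zeta> < 1/2"
        using elim dist_fst_le[of "(x t, q t)" "(\<xi>, \<zeta>)"] dist_snd_le[of "(x t, q t)" "(\<xi>, \<zeta>)"]
        by auto
      then have "((x t, q t), z) \<in> K" "((\<xi>, \<zeta>), z) \<in> K"
        using z by (auto simp: K_def dist_commute)
      moreover have "dist ((x t, q t), z) ((\<xi>, \<zeta>), z) < d"
        using elim by (simp add: dist_Pair_Pair[of _ z])
      ultimately show "dist (g3_block N (x t) (q t) z) (g3_block N \<xi> \<zeta> z) < e"
        using d(2)[of "((\<xi>, \<zeta>), z)" "((x t, q t), z)"] by (simp add: G_def)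
    qed
  qed
qed

text \<open>The constant \<open>D\<close> of the limiting bound is weakened to the midpoint of 1 and
  \<open>D\<close>. This still exceeds 1 and leaves room for the approximation error.\<close>

lemma g3_block_lower_bound:
  assumes "(x \<longlongrightarrow> \<xi>) F" and "(q \<longlongrightarrow> \<zeta>) F"
  shows "\<forall>\<^sub>F t in F. \<forall>z y. z ^ N = of_real y \<and> 0 \<le> y \<and> y \<le> 1 \<longrightarrow>
           (1 + D) / 2 * y\<^sup>2 \<le> norm (g3_block N (x t) (q t) z) \<and> g3_block N (x t) (q t) z \<noteq> 0"
proof -
  \<comment> \<open>Chosen so that \<open>L - e\<close> is at least
    \<open>L * ((1 + D) / (2 * D))\<close> for every \<open>L \<ge> 3 / 4\<close>, which turns an
    absolute error into a relative one.\<close>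
  define e where "e = 3 / 4 * (1 - (1 + D) / (2 * D))"
  have D: "D > 1" by (rule D_gt_1)
  have "e > 0" using D by (simp add: e_def field_simps)
  from g3_block_uniform_limit[OF assms this] show ?thesis
  proof eventually_elim
    case (elim t)
    show ?case
    proof (intro allI impI)
      fix z :: complex and y :: real
      assume *: "z ^ N = of_real y \<and> 0 \<le> y \<and> y \<le> 1"
      then have "norm z ^ N = y"
        by (metis norm_power norm_of_real abs_of_nonneg)
      then have "norm z \<le> 1"
        using * N_pos by (metis linorder_not_le one_less_power)
      define L where "L = norm (g3_block N \<xi> \<zeta> z)"
      have L: "L \<ge> D * y\<^sup>2" "L \<ge> 3 / 4"
        using norm_g3_block_limit_ge[of z y] * by (auto simp: L_def)
      have "dist (g3_block N (x t) (q t) z) (g3_block N \<xi> \<zeta> z) < e"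
        using elim \<open>norm z \<le> 1\<close> by blast
      then have "norm (g3_block N (x t) (q t) z) > L - e"
        unfolding L_def dist_norm using norm_triangle_ineq3
        by (smt (verit) norm_minus_commute norm_triangle_ineq2)
      moreover have "e \<le> L * (1 - (1 + D) / (2 * D))"
        unfolding e_def using L D by (intro mult_right_mono) (auto simp: field_simps)
      then have "L - e \<ge> L * ((1 + D) / (2 * D))"
        by (simp add: algebra_simps)
      moreover have "L * ((1 + D) / (2 * D)) \<ge> D * y\<^sup>2 * ((1 + D) / (2 * D))"
        using L D by (intro mult_right_mono) auto
      moreover have "D * y\<^sup>2 * ((1 + D) / (2 * D)) = (1 + D) / 2 * y\<^sup>2"
        using D by (simp add: field_simps)
      moreover have "(1 + D) / 2 * y\<^sup>2 \<ge> 0"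
        using D by simp
      ultimately have "(1 + D) / 2 * y\<^sup>2 < norm (g3_block N (x t) (q t) z)"
        "0 < norm (g3_block N (x t) (q t) z)"
        by linarith+
      then show "(1 + D) / 2 * y\<^sup>2 \<le> norm (g3_block N (x t) (q t) z) \<and>
          g3_block N (x t) (q t) z \<noteq> 0" by auto
    qed
  qed
qed

text \<open>A vanishing factor would make \<open>\<xi>\<close> or its inverse a power of
  \<open>\<zeta>\<close>, so \<open>\<xi> ^ N = 1\<close>, against \<open>Re_less\<close>.\<close>

lemma qpochs_limit_nz: "qpochs [\<xi>, \<zeta> / \<xi>] \<zeta> n \<noteq> 0"
proof
  assume "qpochs [\<xi>, \<zeta> / \<xi>] \<zeta> n = 0"
  then consider j where "\<xi> * \<zeta> ^ j = 1" | j where "\<zeta> / \<xi> * \<zeta> ^ j = 1"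
    by (auto simp: qpochs_def qpoch_def)
  then obtain w where "\<xi> * w = 1 \<or> w / \<xi> = 1" "w ^ N = 1"
  proof cases
    case (1 j)
    have "(\<zeta> ^ j) ^ N = 1"
      by (metis \<zeta>_root mult.commute power_mult power_one)
    then show ?thesis using that 1 by blast
  next
    case (2 j)
    have "(\<zeta> ^ Suc j) ^ N = 1"
      by (metis \<zeta>_root mult.commute power_mult power_one)
    then show ?thesis using that[of "\<zeta> ^ Suc j"] 2 by simp
  qed
  then have "\<xi> ^ N = 1"
  proof (elim disjE)
    assume "\<xi> * w = 1"
    then have "(\<xi> * w) ^ N = 1" by simp
    then show ?thesis using \<open>w ^ N = 1\<close> by (simp add: power_mult_distrib)
  next
    assume "w / \<xi> = 1"
    then have "w = \<xi>" by simp
    then show ?thesis using \<open>w ^ N = 1\<close> by simp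
  qed
  then show False using Re_less by simp
qed

section \<open>Termwise limits, a geometric majorant, and the limit of the series\<close>

lemma tendsto_g3_term:
  assumes "(x \<longlongrightarrow> \<xi>) F" and "(q \<longlongrightarrow> \<zeta>) F"
  shows "((\<lambda>t. g3_term (x t) (q t) n) \<longlongrightarrow> g3_term \<xi> \<zeta> n) F"
  unfolding g3_term_def
  using qpochs_limit_nz[of n] unfolding qpochs_def
  by (auto intro!: tendsto_intros assms)

text \<open>This is \<open>g3_block_limit\<close> at \<open>y = 1\<close>, since all powers of
  \<open>\<zeta>\<close> in the numerator of the quotient are 1.\<close>

lemma g3_term_limit_add: "g3_term \<xi> \<zeta> (n + N) = g3_term \<xi> \<zeta> n / of_real D"
proof -
  have "(\<zeta> ^ n) ^ N = of_real 1" "\<zeta> ^ (2 * n * N) = 1" "\<zeta> ^ (N * (N - 1)) = 1"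
    using \<zeta>_root by (metis mult.commute of_real_1 power_mult power_one)+
  then show ?thesis
    by (simp add: g3_term_add g3_block_limit D_def)
qed

text \<open>The first \<open>N\<close> terms are controlled by their limits, and each advance by
  \<open>N\<close> costs at most a factor \<open>l ^ N\<close>. The assumption \<open>real\<close>
  places \<open>(q t ^ n) ^ N\<close> in the real interval from 0 to 1, as
  \<open>g3_block_lower_bound\<close> requires.\<close>

lemma g3_term_bound:
  assumes x: "(x \<longlongrightarrow> \<xi>) F" and q: "(q \<longlongrightarrow> \<zeta>) F"
    and real: "\<forall>\<^sub>F t in F. \<exists>y. q t ^ N = of_real y \<and> 0 \<le> y \<and> y \<le> 1"
  obtains C l :: real where "0 < l" "l < 1"
    "\<forall>\<^sub>F t in F. \<forall>n. norm (g3_term (x t) (q t) n) \<le> C * l ^ n"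
proof -
  \<comment> \<open>The \<open>N\<close>-th root spreads the factor \<open>2 / (1 + D)\<close> per
    block evenly over its \<open>N\<close> indices.\<close>
  define l where "l = root N (2 / (1 + D))"
  have D: "D > 1" by (rule D_gt_1)
  have l: "0 < l" "l < 1" "l ^ N = 2 / (1 + D)"
    using D N_pos by (auto simp: l_def)
  \<comment> \<open>The sum replaces a maximum: the summand for \<open>n\<close> alone suffices for
    the term with index \<open>n < N\<close>.\<close>
  define C where "C = (\<Sum>n<N. (norm (g3_term \<xi> \<zeta> n) + 1) / l ^ n)"
  have small: "\<forall>\<^sub>F t in F. \<forall>n\<in>{..<N}. norm (g3_term (x t) (q t) n) < norm (g3_term \<xi> \<zeta> n) + 1"
    by (intro eventually_ball_finite ballI order_tendstoD(2)[OF tendsto_norm[OF tendsto_g3_term[OF x q]]])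
      auto
  have "\<forall>\<^sub>F t in F. \<forall>n. norm (g3_term (x t) (q t) n) \<le> C * l ^ n"
    using small g3_block_lower_bound[OF x q] real
  proof eventually_elim
    case (elim t)
    obtain y where y: "q t ^ N = of_real y" "0 \<le> y" "y \<le> 1"
      using elim(3) by blast
    have step: "norm (g3_term (x t) (q t) (n + N)) \<le> norm (g3_term (x t) (q t) n) * l ^ N" for n
    proof -
      define b where "b = norm (g3_block N (x t) (q t) (q t ^ n))"
      have "(q t ^ n) ^ N = of_real (y ^ n)"
        using y(1) by (metis mult.commute of_real_power power_mult)
      moreover have "0 \<le> y ^ n" "y ^ n \<le> 1"
        using y by (auto simp: power_le_one)
      ultimately have "(1 + D) / 2 * (y ^ n)\<^sup>2 \<le> b \<and> g3_block N (x t) (q t) (q t ^ n) \<noteq> 0"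
        using elim(2) unfolding b_def by blast
      then have b: "(1 + D) / 2 * (y ^ n)\<^sup>2 \<le> b" "b > 0"
        by (auto simp: b_def)
      have nq: "norm (q t) ^ N = y"
        using y by (metis norm_power norm_of_real abs_of_nonneg)
      have "norm (q t ^ (2 * n * N) * q t ^ (N * (N - 1))) = (y ^ n)\<^sup>2 * y ^ (N - 1)"
        by (simp add: norm_mult norm_power nq[symmetric] mult_ac flip: power_mult)
      \<comment> \<open>What remains is exactly the quantity in the lower bound for
        \<open>b\<close>, so the estimate does not depend on \<open>n\<close>.\<close>
      also have "\<dots> \<le> (y ^ n)\<^sup>2"
        using y by (intro mult_left_le power_le_one) auto
      also have "\<dots> \<le> l ^ N * b"
        using b D by (simp add: l field_simps)
      finally have "norm (q t ^ (2 * n * N) * q t ^ (N * (N - 1))) / b \<le> l ^ N"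
        using b by (simp add: field_simps)
      then have "norm (g3_term (x t) (q t) n) *
          (norm (q t ^ (2 * n * N) * q t ^ (N * (N - 1))) / b)
          \<le> norm (g3_term (x t) (q t) n) * l ^ N"
        by (intro mult_left_mono) auto
      then show ?thesis
        unfolding g3_term_add b_def by (simp only: norm_mult norm_divide times_divide_eq_right)
    qed
    show ?case
    proof
      fix n
      show "norm (g3_term (x t) (q t) n) \<le> C * l ^ n"
      proof (induction n rule: less_induct)
        case (less n)
        show ?case
        proof (cases "n < N")
          case True
          have "norm (g3_term (x t) (q t) n) \<le> (norm (g3_term \<xi> \<zeta> n) + 1) / l ^ n * l ^ n"
            using elim(1) True l by (simp add: less_imp_le)
          also have "\<dots> \<le> C * l ^ n"
            unfolding C_def using True l
            by (intro mult_right_mono member_le_sum) auto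
          finally show ?thesis .
        next
          case False
          then obtain m where m: "n = m + N"
            using le_Suc_ex by (metis add.commute not_less)
          then have "norm (g3_term (x t) (q t) n) \<le> norm (g3_term (x t) (q t) m) * l ^ N"
            using step by simp
          also have "\<dots> \<le> C * l ^ m * l ^ N"
            by (rule mult_right_mono[OF less]) (use m N_pos l(1) in simp_all)
          finally show ?thesis by (simp add: m power_add mult_ac)
        qed
      qed
    qed
  qed
  with l show ?thesis using that by blast
qed

theorem tendsto_g3:
  assumes x: "(x \<longlongrightarrow> \<xi>) F" and q: "(q \<longlongrightarrow> \<zeta>) F" and [simp]: "F \<noteq> bot"
    and real: "\<forall>\<^sub>F t in F. \<exists>y. q t ^ N = of_real y \<and> 0 \<le> y \<and> y \<le> 1"
  shows "((\<lambda>t. g3 (x t) (q t)) \<longlongrightarrow> 1 / (1 - 1 / of_real D) * (\<Sum>j=1..N. g3_term \<xi> \<zeta> j)) F"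
proof -
  obtain C l :: real where l: "0 < l" "l < 1"
    and bound: "\<forall>\<^sub>F t in F. \<forall>n. norm (g3_term (x t) (q t) n) \<le> C * l ^ n"
    using g3_term_bound[OF x q real] by metis
  define T where "T = (\<lambda>m. g3_term \<xi> \<zeta> (Suc m))"
  have "summable (\<lambda>m. C * l ^ Suc m)"
    using l by (intro summable_mult) (simp add: summable_mult)
  \<comment> \<open>Tannery's theorem asks for domination on the product filter; here it holds for
    every \<open>m\<close> once \<open>t\<close> is far enough along \<open>F\<close>.\<close>
  moreover have "\<forall>\<^sub>F (m, t) in at_top \<times>\<^sub>F F. norm (g3_term (x t) (q t) (Suc m)) \<le> C * l ^ Suc m"
    unfolding case_prod_beta
    by (rule eventually_mono[OF eventually_prodI[OF eventually_True bound]]) blast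
  ultimately have lim: "summable (\<lambda>m. norm (T m))"
    "((\<lambda>t. \<Sum>m. g3_term (x t) (q t) (Suc m)) \<longlongrightarrow> suminf T) F"
    using tannerys_theorem[of "\<lambda>m t. g3_term (x t) (q t) (Suc m)" T F "\<lambda>m. C * l ^ Suc m"]
      tendsto_g3_term[OF x q] by (auto simp: T_def)
  define S where "S = (\<Sum>j=1..N. g3_term \<xi> \<zeta> j)"
  have D: "norm (1 / of_real D :: complex) < 1"
    using D_gt_1 by (simp add: norm_divide)
  have shift: "g3_term \<xi> \<zeta> (n + i * N) = g3_term \<xi> \<zeta> n * (1 / of_real D) ^ i" for n i
  proof (induction i)
    case (Suc i)
    have "g3_term \<xi> \<zeta> (n + Suc i * N) = g3_term \<xi> \<zeta> ((n + i * N) + N)"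
      by (simp add: algebra_simps)
    then show ?case
      by (simp add: g3_term_limit_add Suc)
  qed simp
  \<comment> \<open>\<open>T\<close> is indexed from 0, so block \<open>i\<close> consists of the
    terms of \<open>g3_term\<close> with indices \<open>i * N + 1\<close> to
    \<open>i * N + N\<close>.\<close>
  have block: "(\<Sum>m\<in>{i * N..<i * N + N}. T m) = S * (1 / of_real D) ^ i" for i
  proof -
    have "(\<Sum>m\<in>{i * N..<i * N + N}. T m) = (\<Sum>j=1..N. T (j - 1 + i * N))"
      by (rule sum.reindex_bij_witness[of _ "\<lambda>j. j - 1 + i * N" "\<lambda>m. Suc (m - i * N)"]) auto
    also have "\<dots> = (\<Sum>j=1..N. g3_term \<xi> \<zeta> (j + i * N))"
      by (intro sum.cong) (auto simp: T_def)
    finally show ?thesis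
      by (simp only: shift S_def sum_distrib_right)
  qed
  have "T sums suminf T"
    by (rule summable_sums[OF summable_norm_cancel[OF lim(1)]])
  then have "(\<lambda>i. S * (1 / of_real D) ^ i) sums suminf T"
    using sums_group[of T _ N] N_pos by (simp add: block)
  moreover have "(\<lambda>i. S * (1 / of_real D) ^ i) sums (S * (1 / (1 - 1 / of_real D)))"
    using D by (intro sums_mult geometric_sums)
  ultimately have "suminf T = 1 / (1 - 1 / of_real D) * S"
    by (metis mult.commute sums_unique2)
  with lim(2) show ?thesis
    by (simp add: g3_eq S_def)
qed

end

section \<open>Arithmetic of the roots of unity \<open>zeta k i\<close>\<close>

lemma zeta_add: "zeta k (i + j) = zeta k i * zeta k j"
  by (simp add: zeta_def algebra_simps add_divide_distrib exp_add)

lemma zeta_power: "zeta k i ^ n = zeta k (i * int n)"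
  by (simp add: zeta_def algebra_simps flip: exp_of_nat_mult)

lemma zeta_minus: "zeta k (- i) = inverse (zeta k i)"
  by (simp add: zeta_def exp_minus)

lemma norm_zeta [simp]: "norm (zeta k i) = 1"
  by (simp add: zeta_def)

lemma zeta_eq_1_iff:
  assumes "k > 0"
  shows "zeta k i = 1 \<longleftrightarrow> int k dvd i"
proof -
  have "zeta k i = 1 \<longleftrightarrow> (\<exists>n::int. 2 * pi * of_int i / real k = of_int (2 * n) * pi)"
    by (simp add: zeta_def exp_eq_1)
  also have "\<dots> \<longleftrightarrow> (\<exists>n::int. of_int i = (of_int (int k * n) :: real))"
    using assms by (simp add: field_simps)
  also have "\<dots> \<longleftrightarrow> int k dvd i"
    by (auto simp only: of_int_eq_iff dvd_def)
  finally show ?thesis .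
qed

text \<open>The order of \<open>zeta k (h * int B)\<close> is \<open>k div gcd k B\<close>: if two
  powers agree, \<open>k\<close> divides \<open>h * B\<close> times the difference of exponents, and
  \<open>h\<close>, the common factor \<open>g\<close> and the cofactor \<open>B div g\<close>
  cancel in turn.\<close>

lemma inj_on_zeta_power:
  assumes "k > 0" and "B > 0" and "coprime h (int k)"
  shows "inj_on (\<lambda>i. zeta k (h * int B) ^ i) {..<k div gcd k B}"
proof -
  define g where "g = gcd k B"
  have g: "g > 0" using assms by (simp add: g_def)
  have aux: "j \<le> i" if "i < k div g" "j < k div g" "i \<le> j"
    "zeta k (h * int B) ^ i = zeta k (h * int B) ^ j" for i j
  proof -
    have "zeta k (h * int B) ^ (j - i) = 1"
      using that(3,4) by (metis le_add_diff_inverse mult_cancel_right1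
          norm_zeta norm_zero power_add power_eq_0_iff zero_neq_one mult.commute)
    then have "int k dvd h * (int B * int (j - i))"
      using assms(1) by (simp add: zeta_power zeta_eq_1_iff mult.assoc)
    then have "int k dvd int (B * (j - i))"
      using assms(3) by (simp add: coprime_commute coprime_dvd_mult_right_iff)
    then have "k dvd B * (j - i)"
      by (simp only: int_dvd_int_iff)
    moreover have "k = (k div g) * g" "B = (B div g) * g"
      by (simp_all add: g_def)
    ultimately have "(k div g) * g dvd (B div g) * (j - i) * g"
      by (metis mult.assoc mult.commute)
    then have "k div g dvd (B div g) * (j - i)"
      using g by simp
    moreover have "coprime (k div g) (B div g)"
      unfolding g_def using assms by (intro div_gcd_coprime) auto
    ultimately have "k div g dvd j - i"
      by (simp add: coprime_dvd_mult_right_iff)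
    then show ?thesis
      using that by (meson dvd_imp_le less_imp_diff_less not_less zero_less_diff)
  qed
  show ?thesis
    unfolding g_def[symmetric]
    by (rule inj_onI) (metis aux le_antisym lessThan_iff nat_le_linear)
qed

text \<open>The interval is centred at \<open>1/2\<close>, so \<open>2 * pi * f\<close> is within
  \<open>2 * pi / 3\<close> of \<open>pi\<close>; monotonicity of the cosine from 0 to
  \<open>pi\<close> then suffices.\<close>

lemma cos_less_half:
  assumes "frac \<theta> \<in> {1/6<..<5/6}"
  shows "cos (2 * pi * \<theta>) < 1 / 2"
proof -
  define f where "f = frac \<theta>"
  have "2 * pi * \<theta> = 2 * pi * f + 2 * pi * of_int \<lfloor>\<theta>\<rfloor>"
    by (simp add: f_def frac_def algebra_simps)
  then have "cos (2 * pi * \<theta>) = cos (2 * pi * f)"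
    by (simp add: cos_add)
  also have "\<dots> = - cos \<bar>2 * pi * f - pi\<bar>"
    by (simp add: cos_diff)
  also have "\<dots> < - cos (2 * pi / 3)"
  proof -
    define u where "u = pi * f"
    have "pi * (1 / 6) < u" "u < pi * (5 / 6)"
      using assms unfolding u_def f_def by (auto intro!: mult_strict_left_mono)
    then have "\<bar>2 * u - pi\<bar> < 2 * pi / 3"
      by linarith
    then have "\<bar>2 * pi * f - pi\<bar> < 2 * pi / 3"
      by (simp add: u_def mult.assoc)
    then have "cos (2 * pi / 3) < cos \<bar>2 * pi * f - pi\<bar>"
      using pi_gt_zero by (intro cos_monotone_0_pi) auto
    then show ?thesis by simp
  qed
  finally show ?thesis by (simp add: cos_120)
qed

section \<open>Radial approach to \<open>zeta k h\<close>\<close>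

theorem theorem2p5:
  fixes a b A B k k' :: nat and h :: int and \<theta> :: real
  assumes "b \<ge> 1" and "B \<ge> 1"
    and "coprime a b"
    and "b = 1 \<Longrightarrow> \<not> B dvd A"
    and "k \<ge> 1"
    and "coprime h (int k)"
    and "k' = k div gcd k B"
    and "\<theta> = real k' * (real a / real b + real A * real_of_int h / real k)"
    and "(of_int h / of_nat k :: rat) \<notin> cusps a b A B"
    and "frac \<theta> \<in> {1/6<..<5/6}"
  shows "has_radial_limit (\<lambda>q. g3 (zeta b (int a) * q ^ A) (q ^ B)) (zeta k h)
    (1 / (1 - 1 / (2 - 2 * complex_of_real (cos (2 * pi * \<theta>)))) *
     (\<Sum>j=1..k'. zeta k (h * int B * int j * (int j - 1)) /
        qpochs [zeta b (int a) * zeta k (h * int A),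
                zeta b (- int a) * zeta k (h * (int B - int A))]
          (zeta k (h * int B)) j))"
proof -
  define \<xi> where "\<xi> = zeta b (int a) * zeta k (h * int A)"
  define \<zeta> where "\<zeta> = zeta k (h * int B)"
  define \<omega> where "\<omega> = \<xi> ^ k'"
  have k': "k' > 0" "int k' * int (gcd k B) = int k"
    using assms(2,5) by (auto simp: assms(7) div_greater_zero_iff simp flip: of_nat_mult)
  have "\<xi> = exp (2 * pi * \<i> * of_real (real a / real b + real A * real_of_int h / real k))"
    by (simp add: \<xi>_def zeta_def algebra_simps flip: exp_add)
  \<comment> \<open>The factor \<open>k'\<close> is part of \<open>\<theta>\<close>, so the
    \<open>k'\<close>-th power of \<open>\<xi>\<close> has argument
    \<open>2 * pi * \<theta>\<close>; this links the hypothesis on \<open>frac \<theta>\<close> to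
    \<open>Re_less\<close>.\<close>
  then have "\<omega> = exp (\<i> * of_real (2 * pi * \<theta>))"
    by (simp add: \<omega>_def assms(8) algebra_simps flip: exp_of_nat_mult)
  then have Re_\<omega>: "Re \<omega> = cos (2 * pi * \<theta>)"
    by (simp add: Re_exp)
  have dvd: "int k dvd h * int B * int k'"
  proof -
    have "h * int B * int k' = h * int (B div gcd k B) * (int k' * int (gcd k B))"
      by (simp add: mult_ac flip: of_nat_mult)
    then show ?thesis by (metis dvd_triv_right k'(2))
  qed
  interpret root_data \<xi> \<zeta> k'
  proof
    show "\<zeta> ^ k' = 1"
      using assms(5) dvd by (simp add: \<zeta>_def zeta_power zeta_eq_1_iff)
    show "inj_on (\<lambda>i. \<zeta> ^ i) {..<k'}"
      unfolding \<zeta>_def assms(7) using assms by (intro inj_on_zeta_power) auto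
    show "Re (\<xi> ^ k') < 1 / 2"
      using cos_less_half[OF assms(10)] Re_\<omega> by (simp add: \<omega>_def)
  qed (use k' in \<open>simp_all add: \<xi>_def norm_mult\<close>)
  define p where "p = (\<lambda>t::real. zeta k h * exp (- of_real t))"
  have p: "(p \<longlongrightarrow> zeta k h) (at_right 0)"
    unfolding p_def by (auto intro!: tendsto_eq_intros)
  have real: "\<forall>\<^sub>F t in at_right 0. \<exists>y. (p t ^ B) ^ k' = of_real y \<and> 0 \<le> y \<and> y \<le> 1"
  proof (rule eventually_at_right_less[THEN eventually_mono])
    fix t :: real
    assume "0 < t"
    \<comment> \<open>On the radius the phase of \<open>p t ^ B\<close> is constantly
      \<open>\<zeta>\<close>, and the power \<open>k'\<close> removes it.\<close>
    have "(p t ^ B) ^ k' = \<zeta> ^ k' * exp (- of_real t) ^ (B * k')"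
      by (simp add: p_def \<zeta>_def power_mult_distrib zeta_power flip: power_mult)
    also have "\<dots> = of_real (exp (- t) ^ (B * k'))"
      by (simp add: \<zeta>_root flip: exp_of_real)
    finally show "\<exists>y. (p t ^ B) ^ k' = of_real y \<and> 0 \<le> y \<and> y \<le> 1"
      using \<open>0 < t\<close> by (intro exI[of _ "exp (- t) ^ (B * k')"]) (simp add: power_le_one)
  qed
  have lim: "((\<lambda>t. g3 (zeta b (int a) * p t ^ A) (p t ^ B)) \<longlongrightarrow>
      1 / (1 - 1 / of_real D) * (\<Sum>j=1..k'. g3_term \<xi> \<zeta> j)) (at_right 0)"
  proof (rule tendsto_g3)
    show "((\<lambda>t. zeta b (int a) * p t ^ A) \<longlongrightarrow> \<xi>) (at_right 0)"
      unfolding \<xi>_def zeta_power[symmetric] by (intro tendsto_intros p)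
    show "((\<lambda>t. p t ^ B) \<longlongrightarrow> \<zeta>) (at_right 0)"
      unfolding \<zeta>_def zeta_power[symmetric] by (intro tendsto_intros p)
  qed (use real in auto)
  have D: "of_real D = 2 - 2 * complex_of_real (cos (2 * pi * \<theta>))"
    using Re_\<omega> by (simp add: D_def \<omega>_def)
  have "g3_term \<xi> \<zeta> j = zeta k (h * int B * int j * (int j - 1)) /
        qpochs [zeta b (int a) * zeta k (h * int A),
                zeta b (- int a) * zeta k (h * (int B - int A))]
          (zeta k (h * int B)) j" if "j \<in> {1..k'}" for j
  proof -
    \<comment> \<open>The bound \<open>j \<ge> 1\<close> matters: it makes truncated subtraction on
      naturals agree with \<open>int j - 1\<close>.\<close>
    have "\<zeta> ^ (j * (j - 1)) = zeta k (h * int B * int j * (int j - 1))"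
      using that by (simp add: \<zeta>_def zeta_power mult.assoc)
    moreover have "\<zeta> / \<xi> = zeta b (- int a) * zeta k (h * (int B - int A))"
      using zeta_add[of k "h * int B" "- (h * int A)"]
      by (simp add: \<zeta>_def \<xi>_def zeta_minus right_diff_distrib divide_inverse mult_ac)
    ultimately show ?thesis
      by (simp add: g3_term_def \<xi>_def[symmetric] \<zeta>_def[symmetric])
  qed
  then have "(\<Sum>j=1..k'. g3_term \<xi> \<zeta> j) =
      (\<Sum>j=1..k'. zeta k (h * int B * int j * (int j - 1)) /
        qpochs [zeta b (int a) * zeta k (h * int A),
                zeta b (- int a) * zeta k (h * (int B - int A))]
          (zeta k (h * int B)) j)"
    by (rule sum.cong[OF refl])
  with lim show ?thesis
    by (simp only: has_radial_limit_def p_def D)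
qed

end
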